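(* Let $\mathscr{M}=\langle S,A,T,R,\kappa\rangle$ be a PSO-MDP with check-in period $\kappa$ and discount factor $\gamma\in[0,1)$, with optimal Q-values $Q^*(s,a)$. Let $\tau$ be an integer with $1\le\tau<\kappa$, and let $\hat{\mathscr{M}}^\tau$ be the modified PSO-MDP with additional check-ins at $\tau$ (in every period), with optimal Q-values $\hat Q^*(s,a_{0:\tau})$ for the action sequences of length $\tau$ taken at regular check-ins. Then $$Q^*(s,a)\ \le\ \hat Q^*(s,a_{0:\tau})\qquad\text{for all } s\in S,\ a\in A^\kappa.$$
   Context: A periodically state-observed Markov Decision Process (PSO-MDP) is a tuple $\langle S,A,T,R,\kappa\rangle$ with $S$ a finite nonempty set of states, $A$ a finite nonempty set of actions, $T:S\times A\times S\to[0,1]$ the Markovian transition model, where $T(s',a,s)=P(s^{t+1}=s'\mid s^t=s,a^t=a)$ (so $\sum_{s'}T(s',a,s)=1$), $R:S\times A\to\mathbb{R}$ the reward function, and $\kappa\in\mathbb{N}_{>0}$ the check-in period. The agent acts at every time step, but the state is revealed to it only at times $0,\kappa,2\kappa,\dots$ (regular check-ins); it maximizes the expected discounted reward $\mathbb{E}\left(\sum_{t\ge0}\gamma^tR(s^t,a^t)\right)$. For an integer $n\ge1$ and $a=(a_0,\dots,a_{n-1})\in A^n$: $$T^{n}(s',a,s)=\sum_{(s_0,\dots,s_n)\in S^{n+1},\ s_0=s,\ s_n=s'}\ \prod_{i=0}^{n-1}T(s_{i+1},a_i,s_i),$$ $$R^{n,\gamma}(s,a)=\sum_{d=0}^{n-1}\gamma^d\sum_{(s_0,\dots,s_d)\in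 S^{d+1},\ s_0=s}R(s_d,a_d)\prod_{i=0}^{d-1}T(s_{i+1},a_i,s_i).$$ For $a\in A^\kappa$, $a_{\ell:m}=(a_\ell,\dots,a_{m-1})$. The optimal Q-values $Q^*:S\times A^\kappa\to\mathbb{R}$ of $\mathscr{M}$ are the unique solution of $$Q^*(s,a)=R^{\kappa,\gamma}(s,a)+\gamma^\kappa\sum_{s'\in S}T^\kappa(s',a,s)\max_{a'\in A^\kappa}Q^*(s',a').$$ PSO-MDP with additional check-ins $\hat{\mathscr{M}}^\tau$: the modification of $\mathscr{M}$ in which, besides the regular check-ins, the state is also revealed $\tau$ steps after every regular check-in (and the agent knows this). A policy specifies, for every state, a sequence of length $\tau$ (taken at regular check-ins, i.e. when the previous sequence had length $\kappa-\tau$) and a sequence of length $\kappa-\tau$ (taken at additional check-ins, i.e. when the previous sequence had length $\tau$). Its optimal Q-values are the unique pair of functions $\hat Q^*:S\times A^\tau\to\mathbb{R}$ (for regular check-ins) and $\hat P^*:S\times A^{\kappa-\tau}\to\mathbb{R}$ (for additional check-ins) satisfying, for all $s\in S$, $c\in A^\tau$, $b\in A^{\kappa-\tau}$, $$\hat Q^*(s,c)=R^{\tau,\gamma}(s,c)+\gamma^\tau\sum_{s'\in S}T^\tau(s',c,s)\max_{b'\in A^{\kappa-\tau}}\hat P^*(s',b'),$$ $$\hat P^*(s,b)=R^{\kappa-\tau,\gamma}(s,b)+\gamma^{\kappa-\tau}\sum_{s'\in S}T^{\kappa-\tau}(s',b,s)\max_{c'\in A^\tau}\hat Q^*(s',c').$$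 *)

theory Defs
  imports "HOL-Analysis.Analysis"
begin

text \<open>The finite nonempty sets of states and actions are types of class \<open>finite\<close>.
  The arguments of the transition model are ordered as in \<open>T(s', a, s) = P(s' | s, a)\<close>:
  successor state first.\<close>

record ('s, 'a) pso_mdp =
  transition :: "'s \<Rightarrow> 'a \<Rightarrow> 's \<Rightarrow> real"
  reward :: "'s \<Rightarrow> 'a \<Rightarrow> real"
  period :: nat

definition is_pso_mdp :: "('s::finite, 'a::finite) pso_mdp \<Rightarrow> bool" where
  "is_pso_mdp M \<longleftrightarrow>
     (\<forall>s' a s. transition M s' a s \<in> {0..1}) \<and>
     (\<forall>a s. (\<Sum>s'\<in>UNIV. transition M s' a s) = 1) \<and>
     period M > 0"

definition seqs :: "nat \<Rightarrow> 'a list set" where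
  "seqs n = {a. length a = n}"

definition path_prob :: "('s, 'a) pso_mdp \<Rightarrow> nat \<Rightarrow> 'a list \<Rightarrow> 's list \<Rightarrow> real" where
  "path_prob M n a p = (\<Prod>i<n. transition M (p ! (i + 1)) (a ! i) (p ! i))"

definition trans_n ::
    "('s::finite, 'a::finite) pso_mdp \<Rightarrow> nat \<Rightarrow> 's \<Rightarrow> 'a list \<Rightarrow> 's \<Rightarrow> real" where
  "trans_n M n s' a s = (\<Sum>p | p \<in> seqs (n + 1) \<and> p ! 0 = s \<and> p ! n = s'. path_prob M n a p)"

definition reward_n ::
    "('s::finite, 'a::finite) pso_mdp \<Rightarrow> real \<Rightarrow> nat \<Rightarrow> 's \<Rightarrow> 'a list \<Rightarrow> real" where
  "reward_n M \<gamma> n s a =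
     (\<Sum>d<n. \<gamma> ^ d * (\<Sum>p | p \<in> seqs (d + 1) \<and> p ! 0 = s. reward M (p ! d) (a ! d) * path_prob M d a p))"

text \<open>A function on \<open>S \<times> A\<^sup>n\<close> is a function on all lists that is \<open>undefined\<close> on lists
  of any other length; without this the solutions below would
  not be unique. Existence and uniqueness, which justify \<open>THE\<close>, are \<open>bellman_unique_solution\<close>
  and \<open>bellman_add_unique_solution\<close>.\<close>

definition bellman :: "('s::finite, 'a::finite) pso_mdp \<Rightarrow> real \<Rightarrow> ('s \<Rightarrow> 'a list \<Rightarrow> real) \<Rightarrow> bool" where
  "bellman M \<gamma> Q \<longleftrightarrow>
     (\<forall>s. Q s \<in> extensional (seqs (period M))) \<and>
     (\<forall>s. \<forall>a\<in>seqs (period M).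
        Q s a = reward_n M \<gamma> (period M) s a +
          \<gamma> ^ period M * (\<Sum>s'\<in>UNIV. trans_n M (period M) s' a s * (MAX a'\<in>seqs (period M). Q s' a')))"

definition opt_Q :: "('s::finite, 'a::finite) pso_mdp \<Rightarrow> real \<Rightarrow> 's \<Rightarrow> 'a list \<Rightarrow> real" where
  "opt_Q M \<gamma> = (THE Q. bellman M \<gamma> Q)"

text \<open>The modified process reveals the state \<open>\<tau>\<close> steps after every regular check-in as well:
  \<open>Q\<close> is the value at regular and \<open>P\<close> the value at additional check-ins.\<close>

definition bellman_add ::
    "('s::finite, 'a::finite) pso_mdp \<Rightarrow> real \<Rightarrow> nat \<Rightarrow>
     ('s \<Rightarrow> 'a list \<Rightarrow> real) \<times> ('s \<Rightarrow> 'a list \<Rightarrow> real) \<Rightarrow> bool" where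
  "bellman_add M \<gamma> \<tau> = (\<lambda>(Q, P).
     (\<forall>s. Q s \<in> extensional (seqs \<tau>)) \<and>
     (\<forall>s. P s \<in> extensional (seqs (period M - \<tau>))) \<and>
     (\<forall>s. \<forall>c\<in>seqs \<tau>.
        Q s c = reward_n M \<gamma> \<tau> s c +
          \<gamma> ^ \<tau> * (\<Sum>s'\<in>UNIV. trans_n M \<tau> s' c s * (MAX b'\<in>seqs (period M - \<tau>). P s' b'))) \<and>
     (\<forall>s. \<forall>b\<in>seqs (period M - \<tau>).
        P s b = reward_n M \<gamma> (period M - \<tau>) s b +
          \<gamma> ^ (period M - \<tau>) *
            (\<Sum>s'\<in>UNIV. trans_n M (period M - \<tau>) s' b s * (MAX c'\<in>seqs \<tau>. Q s' c'))))"

definition opt_Q_add ::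
    "('s::finite, 'a::finite) pso_mdp \<Rightarrow> real \<Rightarrow> nat \<Rightarrow> 's \<Rightarrow> 'a list \<Rightarrow> real" where
  "opt_Q_add M \<gamma> \<tau> = fst (THE QP. bellman_add M \<gamma> \<tau> QP)"

definition opt_P_add ::
    "('s::finite, 'a::finite) pso_mdp \<Rightarrow> real \<Rightarrow> nat \<Rightarrow> 's \<Rightarrow> 'a list \<Rightarrow> real" where
  "opt_P_add M \<gamma> \<tau> = snd (THE QP. bellman_add M \<gamma> \<tau> QP)"

lemma finite_seqs [simp]: "finite (seqs n :: 'a::finite list set)"
  using finite_lists_length_eq[of "UNIV :: 'a set" n] by (simp add: seqs_def)

lemma seqs_nonempty [simp]: "seqs n \<noteq> {}"
  using length_replicate[of n undefined] by (auto simp: seqs_def simp del: length_replicate)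

lemma path_prob_nonneg: "is_pso_mdp M \<Longrightarrow> path_prob M n a p \<ge> 0"
  unfolding path_prob_def is_pso_mdp_def by (intro prod_nonneg) auto

lemma sum_path_prob:
  fixes M :: "('s::finite, 'a::finite) pso_mdp"
  assumes M: "is_pso_mdp M"
  shows "(\<Sum>p | p \<in> seqs (n + 1) \<and> p ! 0 = s. path_prob M n a p) = 1"
proof (induction n)
  case 0
  have "{p. p \<in> seqs (0 + 1) \<and> p ! 0 = s} = {[s]}"
    by (auto simp: seqs_def length_Suc_conv)
  then show ?case by (simp add: path_prob_def)
next
  case (Suc n)
  define P where "P n = {p::'s list. p \<in> seqs (n + 1) \<and> p ! 0 = s}" for n
  define g where "g = (\<lambda>(p::'s list, x). p @ [x])"
  have inj: "inj_on g (P n \<times> UNIV)" by (auto simp: inj_on_def g_def)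
  have img: "g ` (P n \<times> UNIV) = P (Suc n)"
  proof (intro equalityI subsetI)
    fix p assume "p \<in> g ` (P n \<times> UNIV)"
    then show "p \<in> P (Suc n)" by (auto simp: g_def P_def seqs_def nth_append)
  next
    fix p assume p: "p \<in> P (Suc n)"
    then have "p \<noteq> []" by (auto simp: P_def seqs_def)
    then have "p = g (butlast p, last p)" by (simp add: g_def)
    moreover have "butlast p \<in> P n" using p by (auto simp: P_def seqs_def nth_butlast)
    ultimately show "p \<in> g ` (P n \<times> UNIV)" by blast
  qed
  have step: "path_prob M (Suc n) a (p @ [x]) = path_prob M n a p * transition M x (a ! n) (p ! n)"
    if "p \<in> P n" for p x
  proof -
    have "length p = Suc n" using that by (simp add: P_def seqs_def)
    then show ?thesis unfolding path_prob_def by (simp add: nth_append)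
  qed
  have "(\<Sum>p\<in>P (Suc n). path_prob M (Suc n) a p) =
        (\<Sum>y\<in>P n \<times> UNIV. path_prob M (Suc n) a (g y))"
    using sum.reindex[OF inj, of "path_prob M (Suc n) a"] img by simp
  also have "\<dots> = (\<Sum>p\<in>P n. \<Sum>x\<in>UNIV. path_prob M (Suc n) a (p @ [x]))"
    by (simp add: sum.cartesian_product g_def case_prod_unfold)
  also have "\<dots> = (\<Sum>p\<in>P n. path_prob M n a p * (\<Sum>x\<in>UNIV. transition M x (a ! n) (p ! n)))"
    by (simp add: step sum_distrib_left)
  also have "\<dots> = (\<Sum>p\<in>P n. path_prob M n a p)"
    using M by (simp add: is_pso_mdp_def)
  also have "\<dots> = 1" using Suc.IH by (simp add: P_def)
  finally show ?case by (simp add: P_def)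
qed

lemma trans_n_nonneg: "is_pso_mdp M \<Longrightarrow> trans_n M n s' a s \<ge> 0"
  unfolding trans_n_def by (intro sum_nonneg path_prob_nonneg)

lemma sum_trans_n:
  fixes M :: "('s::finite, 'a::finite) pso_mdp"
  assumes M: "is_pso_mdp M"
  shows "(\<Sum>s'\<in>UNIV. trans_n M n s' a s) = 1"
proof -
  define P where "P = {p::'s list. p \<in> seqs (n + 1) \<and> p ! 0 = s}"
  have fin: "finite P" unfolding P_def by (rule finite_subset[OF _ finite_seqs]) auto
  have "(\<Sum>s'\<in>UNIV. trans_n M n s' a s) =
        (\<Sum>s'\<in>UNIV. \<Sum>p | p \<in> P \<and> p ! n = s'. path_prob M n a p)"
    by (simp add: trans_n_def P_def)
  also have "\<dots> = (\<Sum>p\<in>P. path_prob M n a p)"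
    by (rule sum.group) (use fin in auto)
  finally show ?thesis using sum_path_prob[OF M] by (simp add: P_def)
qed

definition backup_Q ::
    "('s::finite, 'a::finite) pso_mdp \<Rightarrow> real \<Rightarrow> nat \<Rightarrow> ('s \<Rightarrow> real) \<Rightarrow> 's \<Rightarrow> 'a list \<Rightarrow> real" where
  "backup_Q M \<gamma> n V s =
     restrict (\<lambda>a. reward_n M \<gamma> n s a + \<gamma> ^ n * (\<Sum>s'\<in>UNIV. trans_n M n s' a s * V s')) (seqs n)"

definition backup_V ::
    "('s::finite, 'a::finite) pso_mdp \<Rightarrow> real \<Rightarrow> nat \<Rightarrow> ('s \<Rightarrow> real) \<Rightarrow> 's \<Rightarrow> real" where
  "backup_V M \<gamma> n V s = (MAX a\<in>seqs n. backup_Q M \<gamma> n V s a)"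

lemma eq_restrict_iff: "f = restrict g A \<longleftrightarrow> f \<in> extensional A \<and> (\<forall>a\<in>A. f a = g a)"
  unfolding fun_eq_iff extensional_def by auto

lemma eq_backup_Q_iff:
  "Q = backup_Q M \<gamma> n V \<longleftrightarrow>
     (\<forall>s. Q s \<in> extensional (seqs n)) \<and>
     (\<forall>s. \<forall>a\<in>seqs n. Q s a =
        reward_n M \<gamma> n s a + \<gamma> ^ n * (\<Sum>s'\<in>UNIV. trans_n M n s' a s * V s'))"
  unfolding fun_eq_iff[of Q] backup_Q_def eq_restrict_iff by (simp only: all_conj_distrib)

lemma bellman_iff:
  "bellman M \<gamma> Q \<longleftrightarrow> Q = backup_Q M \<gamma> (period M) (\<lambda>s. MAX a\<in>seqs (period M). Q s a)"
  unfolding bellman_def by (subst eq_backup_Q_iff) (rule refl)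

lemma bellman_add_iff:
  "bellman_add M \<gamma> \<tau> (Q, P) \<longleftrightarrow>
     Q = backup_Q M \<gamma> \<tau> (\<lambda>s. MAX b\<in>seqs (period M - \<tau>). P s b) \<and>
     P = backup_Q M \<gamma> (period M - \<tau>) (\<lambda>s. MAX c\<in>seqs \<tau>. Q s c)"
  unfolding bellman_add_def prod.case eq_backup_Q_iff by (simp only: conj_ac)

lemma backup_V_le:
  fixes M :: "('s::finite, 'a::finite) pso_mdp"
  assumes M: "is_pso_mdp M" and \<gamma>: "0 \<le> \<gamma>" and VW: "\<And>s. V s \<le> W s + K"
  shows "backup_V M \<gamma> n V s \<le> backup_V M \<gamma> n W s + \<gamma> ^ n * K"
proof -
  have "backup_Q M \<gamma> n V s a \<le> backup_V M \<gamma> n W s + \<gamma> ^ n * K"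
    if a: "a \<in> seqs n" for a :: "'a list"
  proof -
    have "(\<Sum>s'\<in>UNIV. trans_n M n s' a s * V s') \<le> (\<Sum>s'\<in>UNIV. trans_n M n s' a s * (W s' + K))"
      by (intro sum_mono mult_left_mono VW trans_n_nonneg M)
    also have "\<dots> = (\<Sum>s'\<in>UNIV. trans_n M n s' a s * W s') + K"
      using sum_trans_n[OF M, of n a s]
      by (simp add: distrib_left sum.distrib flip: sum_distrib_right)
    finally have "\<gamma> ^ n * (\<Sum>s'\<in>UNIV. trans_n M n s' a s * V s') \<le>
        \<gamma> ^ n * ((\<Sum>s'\<in>UNIV. trans_n M n s' a s * W s') + K)"
      by (rule mult_left_mono) (use \<gamma> in simp)
    then have "backup_Q M \<gamma> n V s a \<le> backup_Q M \<gamma> n W s a + \<gamma> ^ n * K"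
      using a by (simp add: backup_Q_def algebra_simps)
    moreover have "backup_Q M \<gamma> n W s a \<le> backup_V M \<gamma> n W s"
      unfolding backup_V_def using a by (intro Max_ge) auto
    ultimately show ?thesis by linarith
  qed
  then show ?thesis unfolding backup_V_def[of M \<gamma> n V] by (intro Max.boundedI) auto
qed

lemma backup_V_contraction:
  fixes M :: "('s::finite, 'a::finite) pso_mdp"
  assumes M: "is_pso_mdp M" and \<gamma>: "0 \<le> \<gamma>" and VW: "\<And>s. \<bar>V s - W s\<bar> \<le> K"
  shows "\<bar>backup_V M \<gamma> n V s - backup_V M \<gamma> n W s\<bar> \<le> \<gamma> ^ n * K"
proof -
  have "V s \<le> W s + K" for s using VW[of s] by linarith
  then have 1: "backup_V M \<gamma> n V s \<le> backup_V M \<gamma> n W s + \<gamma> ^ n * K"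
    by (rule backup_V_le[OF M \<gamma>])
  have "W s \<le> V s + K" for s using VW[of s] by linarith
  then have 2: "backup_V M \<gamma> n W s \<le> backup_V M \<gamma> n V s + \<gamma> ^ n * K"
    by (rule backup_V_le[OF M \<gamma>])
  from 1 2 show ?thesis by linarith
qed

lemma sup_contraction_fixpoint:
  fixes F :: "('s::finite \<Rightarrow> real) \<Rightarrow> 's \<Rightarrow> real"
  assumes c: "0 \<le> c" "c < 1"
    and contr: "\<And>V W K s. (\<And>s. \<bar>V s - W s\<bar> \<le> K) \<Longrightarrow> \<bar>F V s - F W s\<bar> \<le> c * K"
  shows "\<exists>!V. F V = V"
proof -
  have iter: "\<bar>(F ^^ n) V s - (F ^^ n) W s\<bar> \<le> c ^ n * K" if "\<And>s. \<bar>V s - W s\<bar> \<le> K" for V W K n s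
  proof (induction n arbitrary: s)
    case (Suc n)
    from Suc have "\<bar>F ((F ^^ n) V) s - F ((F ^^ n) W) s\<bar> \<le> c * (c ^ n * K)" by (rule contr)
    then show ?case by (simp add: mult.assoc)
  qed (use that in simp)
  have bounded: "\<exists>K. \<forall>s. \<bar>V s - W s\<bar> \<le> K" for V W :: "'s \<Rightarrow> real"
    by (rule exI[of _ "\<Sum>s\<in>UNIV. \<bar>V s - W s\<bar>"]) (auto intro: member_le_sum)
  have c0: "(\<lambda>n. c ^ n * K) \<longlonglongrightarrow> 0" for K
    using tendsto_mult_left_zero[OF LIMSEQ_realpow_zero[OF c]] .
  define X where "X n = (F ^^ n) (\<lambda>_. 0)" for n
  define L where "L s = lim (\<lambda>n. X n s)" for s
  obtain K where K: "\<And>s. \<bar>X 1 s - X 0 s\<bar> \<le> K" using bounded[of "X 1" "X 0"] by blast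
  have X: "(F ^^ n) (X m) = X (n + m)" for n m
    by (simp add: X_def funpow_add)
  have bd: "norm (X (Suc n) s - X n s) \<le> c ^ n * K" for n s
    using iter[of "X 1" "X 0" K n s, OF K] by (simp add: X)
  have sumc: "summable (\<lambda>n. c ^ n * K)"
    using c by (intro summable_mult2 summable_geometric) simp
  have "summable (\<lambda>n. X (Suc n) s - X n s)" for s
    by (rule summable_comparison_test'[OF sumc bd])
  moreover have "(\<Sum>i<n. X (Suc i) s - X i s) = X n s - X 0 s" for n s
    by (rule sum_lessThan_telescope)
  ultimately have "convergent (\<lambda>n. X n s - X 0 s)" for s
    by (simp only: summable_iff_convergent)
  then have "convergent (\<lambda>n. (X n s - X 0 s) + X 0 s)" for s
    by (rule convergent_add[OF _ convergent_const])
  then have L: "(\<lambda>n. X n s) \<longlonglongrightarrow> L s" for s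
    unfolding L_def by (simp add: convergent_LIMSEQ_iff)
  have "F L s = L s" for s
  proof -
    define D where "D n = (\<Sum>s\<in>UNIV. \<bar>X n s - L s\<bar>)" for n
    have "D \<longlonglongrightarrow> (\<Sum>s\<in>(UNIV::'s set). \<bar>L s - L s\<bar>)"
      unfolding D_def by (intro tendsto_intros L)
    then have cD: "(\<lambda>n. c * D n) \<longlonglongrightarrow> 0" by (simp add: tendsto_mult_right_zero)
    have "\<bar>F (X n) s - F L s\<bar> \<le> c * D n" for n
    proof (rule contr)
      show "\<bar>X n s - L s\<bar> \<le> D n" for s
        unfolding D_def by (rule member_le_sum) simp_all
    qed
    then have "(\<lambda>n. X (Suc n) s - F L s) \<longlonglongrightarrow> 0"
      by (intro Lim_null_comparison[OF _ cD] always_eventually) (simp add: X_def)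
    then have "(\<lambda>n. X (Suc n) s) \<longlonglongrightarrow> F L s" by (rule LIM_zero_cancel)
    then show ?thesis by (rule LIMSEQ_unique[OF _ LIMSEQ_Suc[OF L]])
  qed
  then have "F L = L" by (simp add: fun_eq_iff)
  moreover have "V = W" if fp: "F V = V" "F W = W" for V W
  proof
    fix s
    have VW: "(F ^^ n) V = V" "(F ^^ n) W = W" for n using fp by (induction n) auto
    obtain K where "\<And>s. \<bar>V s - W s\<bar> \<le> K" using bounded[of V W] by blast
    from iter[of V W K _ s, OF this] have "\<bar>V s - W s\<bar> \<le> c ^ n * K" for n by (simp only: VW)
    then have "\<bar>V s - W s\<bar> \<le> 0" by (intro LIMSEQ_le_const[OF c0[of K]]) blast
    then show "V s = W s" by simp
  qed
  ultimately show ?thesis by blast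
qed

theorem bellman_unique_solution:
  fixes M :: "('s::finite, 'a::finite) pso_mdp"
  assumes M: "is_pso_mdp M" and \<gamma>: "0 \<le> \<gamma>" "\<gamma> < 1"
  shows "\<exists>!Q. bellman M \<gamma> Q"
proof -
  let ?k = "period M"
  have "\<gamma> ^ ?k < 1" using M \<gamma> by (simp add: is_pso_mdp_def power_less_one_iff)
  then have ex1: "\<exists>!V. backup_V M \<gamma> ?k V = V"
    using M \<gamma> by (intro sup_contraction_fixpoint[of "\<gamma> ^ ?k"] backup_V_contraction) auto
  then obtain V where V: "backup_V M \<gamma> ?k V = V" by blast
  have "bellman M \<gamma> (backup_Q M \<gamma> ?k V)"
    unfolding bellman_iff using V by (simp add: backup_V_def[abs_def])
  moreover have "Q = backup_Q M \<gamma> ?k V" if "bellman M \<gamma> Q" for Q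
  proof -
    let ?W = "\<lambda>s. MAX a\<in>seqs ?k. Q s a"
    have Q: "Q = backup_Q M \<gamma> ?k ?W" using that by (simp add: bellman_iff)
    have "backup_V M \<gamma> ?k ?W = ?W" unfolding backup_V_def[abs_def] Q[symmetric] ..
    then have "?W = V" using V ex1 by blast
    then show ?thesis using Q by (simp only:)
  qed
  ultimately show ?thesis by blast
qed

theorem bellman_add_unique_solution:
  fixes M :: "('s::finite, 'a::finite) pso_mdp"
  assumes M: "is_pso_mdp M" and \<gamma>: "0 \<le> \<gamma>" "\<gamma> < 1" and \<tau>: "1 \<le> \<tau>" "\<tau> < period M"
  shows "\<exists>!QP. bellman_add M \<gamma> \<tau> QP"
proof -
  let ?m = "period M - \<tau>"
  let ?F = "\<lambda>V. backup_V M \<gamma> \<tau> (backup_V M \<gamma> ?m V)"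
  have "\<gamma> ^ \<tau> * \<gamma> ^ ?m < 1"
    using \<gamma> \<tau> by (simp add: power_less_one_iff flip: power_add)
  moreover have "\<bar>?F V s - ?F W s\<bar> \<le> \<gamma> ^ \<tau> * \<gamma> ^ ?m * K" if "\<And>s. \<bar>V s - W s\<bar> \<le> K" for V W K s
    unfolding mult.assoc
    by (intro backup_V_contraction[OF M \<gamma>(1)] that)
  ultimately have ex1: "\<exists>!V. ?F V = V"
    by (intro sup_contraction_fixpoint[of "\<gamma> ^ \<tau> * \<gamma> ^ ?m"]) (use \<gamma> in auto)
  then obtain V where V: "?F V = V" by blast
  let ?P = "backup_Q M \<gamma> ?m V" and ?Q = "backup_Q M \<gamma> \<tau> (backup_V M \<gamma> ?m V)"
  have "bellman_add M \<gamma> \<tau> (?Q, ?P)"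
    unfolding bellman_add_iff using V by (simp add: backup_V_def[abs_def])
  moreover have "QP = (?Q, ?P)" if QP: "bellman_add M \<gamma> \<tau> QP" for QP
  proof -
    obtain Q P where eq: "QP = (Q, P)" by (cases QP)
    let ?W = "\<lambda>s. MAX c\<in>seqs \<tau>. Q s c" and ?U = "\<lambda>s. MAX b\<in>seqs ?m. P s b"
    have Q: "Q = backup_Q M \<gamma> \<tau> ?U" and P: "P = backup_Q M \<gamma> ?m ?W"
      using QP unfolding eq bellman_add_iff by blast+
    have U: "backup_V M \<gamma> ?m ?W = ?U" unfolding backup_V_def[abs_def] P[symmetric] ..
    have "backup_V M \<gamma> \<tau> ?U = ?W" unfolding backup_V_def[abs_def] Q[symmetric] ..
    then have "?F ?W = ?W" by (simp only: U)
    then have W: "?W = V" using V ex1 by blast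
    have "backup_V M \<gamma> ?m V = ?U" using U unfolding W .
    then have "Q = ?Q" by (simp only: Q[symmetric])
    moreover have "P = ?P" using P unfolding W .
    ultimately show ?thesis unfolding eq by (rule arg_cong2)
  qed
  ultimately show ?thesis by blast
qed

end

theory Submission
  imports Defs
begin

text \<open>Committing to \<open>\<kappa>\<close> actions at once is worth at most as much as committing to the first \<open>\<tau>\<close>
  and choosing the rest after a look at the state. So the value function of \<open>M\<close> is a
  sub-fixpoint of the two-stage backup of the modified process. That backup is monotone
  and a contraction, hence its fixpoint dominates every sub-fixpoint.\<close>

text \<open>A path from \<open>s\<close> is \<open>s\<close> followed by an arbitrary path, and
  grouping the tails by their first state \<open>x\<close> splits off the first transition. The
  weight \<open>f\<close> is left free so that one identity serves both kernels: an indicator of the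
  endpoint gives \<open>trans_n\<close>, the reward at the last state gives the terms of
  \<open>reward_n\<close>.\<close>

lemma sum_paths_Cons:
  fixes M :: "('s::finite, 'a::finite) pso_mdp"
  shows "(\<Sum>p | p \<in> seqs (Suc (n + 1)) \<and> p ! 0 = s. f p * path_prob M (Suc n) (a # as) p) =
    (\<Sum>x\<in>UNIV. transition M x a s *
      (\<Sum>p | p \<in> seqs (n + 1) \<and> p ! 0 = x. f (s # p) * path_prob M n as p))"
proof -
  let ?P = "\<lambda>n x. {p::'s list. p \<in> seqs (n + 1) \<and> p ! 0 = x}"
  have prob: "path_prob M (Suc n) (a # as) (s # p) = transition M (p ! 0) a s * path_prob M n as p" for p
    unfolding path_prob_def by (subst prod.lessThan_Suc_shift) simp
  have "?P (Suc n) s = (#) s ` seqs (n + 1)"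
    by (auto simp: seqs_def length_Suc_conv)
  then have "(\<Sum>p\<in>?P (Suc n) s. f p * path_prob M (Suc n) (a # as) p) =
      (\<Sum>p\<in>seqs (n + 1). f (s # p) * (transition M (p ! 0) a s * path_prob M n as p))"
    by (simp add: sum.reindex prob)
  also have "\<dots> = (\<Sum>x\<in>UNIV. \<Sum>p\<in>?P n x. f (s # p) * (transition M (p ! 0) a s * path_prob M n as p))"
    by (rule sum.group[symmetric]) simp_all
  also have "\<dots> = (\<Sum>x\<in>UNIV. transition M x a s * (\<Sum>p\<in>?P n x. f (s # p) * path_prob M n as p))"
    unfolding sum_distrib_left by (intro sum.cong refl) (auto simp: mult_ac)
  finally show ?thesis by simp
qed

text \<open>Moves the endpoint condition from the index set into the summand, the shape that
  \<open>sum_paths_Cons\<close> handles.\<close>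

lemma trans_n_eq_sum_of_bool:
  "trans_n M n s' a s = (\<Sum>p | p \<in> seqs (n + 1) \<and> p ! 0 = s. of_bool (p ! n = s') * path_prob M n a p)"
proof -
  have "finite {p::'a list. p \<in> seqs (n + 1) \<and> p ! 0 = s}"
    by (rule finite_subset[OF _ finite_seqs]) auto
  then show ?thesis
    unfolding trans_n_def by (intro sum.mono_neutral_cong_left) auto
qed

lemma trans_n_0: "trans_n M 0 s' a s = of_bool (s = s')"
proof -
  have "{p. p \<in> seqs 1 \<and> p ! 0 = s} = {[s]}"
    by (auto simp: seqs_def length_Suc_conv)
  then show ?thesis by (simp add: trans_n_eq_sum_of_bool path_prob_def)
qed

lemma trans_n_Suc:
  "trans_n M (Suc n) s' (a # as) s = (\<Sum>x\<in>UNIV. transition M x a s * trans_n M n s' as x)"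
  using sum_paths_Cons[of "\<lambda>p. of_bool (p ! Suc n = s')" M n a as s]
  by (simp add: trans_n_eq_sum_of_bool)

lemma reward_n_Suc:
  "reward_n M \<gamma> (Suc n) s (a # as) =
    reward M s a + \<gamma> * (\<Sum>x\<in>UNIV. transition M x a s * reward_n M \<gamma> n x as)"
proof -
  define r where "r d s a = (\<Sum>p | p \<in> seqs (d + 1) \<and> p ! 0 = s.
    reward M (p ! d) (a ! d) * path_prob M d a p)" for d s a
  have reward_n: "reward_n M \<gamma> n s a = (\<Sum>d<n. \<gamma> ^ d * r d s a)" for n s a
    by (simp add: reward_n_def r_def)
  have "{p. p \<in> seqs 1 \<and> p ! 0 = s} = {[s]}"
    by (auto simp: seqs_def length_Suc_conv)
  then have r0: "r 0 s (a # as) = reward M s a"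
    by (simp add: r_def path_prob_def)
  have rS: "r (Suc d) s (a # as) = (\<Sum>x\<in>UNIV. transition M x a s * r d x as)" for d
    using sum_paths_Cons[of "\<lambda>p. reward M (p ! Suc d) (as ! d)" M d a as s]
    by (simp add: r_def)
  \<comment> \<open>The term for \<open>d = 0\<close> is the immediate reward. Every later term
    passes through the successor \<open>x\<close> and gives up one factor \<gamma>.\<close>
  have "reward_n M \<gamma> (Suc n) s (a # as) =
      reward M s a + (\<Sum>d<n. \<Sum>x\<in>UNIV. \<gamma> * (transition M x a s * (\<gamma> ^ d * r d x as)))"
    unfolding reward_n
    by (subst sum.lessThan_Suc_shift) (simp add: r0 rS sum_distrib_left mult_ac)
  also have "\<dots> = reward M s a + (\<Sum>x\<in>UNIV. \<Sum>d<n. \<gamma> * (transition M x a s * (\<gamma> ^ d * r d x as)))"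
    by (subst sum.swap) (rule refl)
  finally show ?thesis by (simp add: reward_n sum_distrib_left)
qed

lemma backup_Q_Nil: "backup_Q M \<gamma> 0 V s [] = V s"
  by (simp add: backup_Q_def seqs_def reward_n_def trans_n_0 of_bool_def if_distrib[of "\<lambda>x. x * _"] cong: if_cong)

text \<open>Together with \<open>backup_Q_Nil\<close> this gives a recursion on the action list, so
  that backups can be composed by list induction without returning to sums over paths.\<close>

lemma backup_Q_Cons:
  assumes "length as = n"
  shows "backup_Q M \<gamma> (Suc n) V s (a # as) =
    reward M s a + \<gamma> * (\<Sum>x\<in>UNIV. transition M x a s * backup_Q M \<gamma> n V x as)"
proof -
  have "(\<Sum>s'\<in>UNIV. trans_n M (Suc n) s' (a # as) s * V s') =
      (\<Sum>x\<in>UNIV. transition M x a s * (\<Sum>s'\<in>UNIV. trans_n M n s' as x * V s'))"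
    unfolding trans_n_Suc sum_distrib_right sum_distrib_left
    by (subst sum.swap) (simp add: mult_ac)
  moreover have "reward_n M \<gamma> (Suc n) s (a # as) + \<gamma> ^ Suc n *
      (\<Sum>x\<in>UNIV. transition M x a s * (\<Sum>s'\<in>UNIV. trans_n M n s' as x * V s')) =
    reward M s a + \<gamma> * (\<Sum>x\<in>UNIV. transition M x a s *
      (reward_n M \<gamma> n x as + \<gamma> ^ n * (\<Sum>s'\<in>UNIV. trans_n M n s' as x * V s')))"
    by (simp add: reward_n_Suc distrib_left sum.distrib sum_distrib_left mult_ac)
  ultimately show ?thesis using assms
    by (simp add: backup_Q_def seqs_def)
qed

text \<open>The value of executing \<open>b\<close> serves as terminal value for executing
  \<open>c\<close>. This combines the Chapman-Kolmogorov equation for the kernels with the splitting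
  of the discounted reward at time \<open>length c\<close>.\<close>

lemma backup_Q_append:
  assumes "length b = m"
  shows "backup_Q M \<gamma> (length c + m) V s (c @ b) = backup_Q M \<gamma> (length c) (\<lambda>x. backup_Q M \<gamma> m V x b) s c"
proof (induction c arbitrary: s)
  case Nil
  show ?case by (simp add: backup_Q_Nil)
next
  case (Cons a c)
  then show ?case using assms by (simp add: backup_Q_Cons)
qed

lemma backup_Q_le_backup_V:
  "a \<in> seqs n \<Longrightarrow> backup_Q M \<gamma> n V s a \<le> backup_V M \<gamma> n V s"
  unfolding backup_V_def by (intro Max_ge) auto

lemma backup_Q_mono:
  assumes "is_pso_mdp M" "0 \<le> \<gamma>" "\<And>s. V s \<le> W s"
  shows "backup_Q M \<gamma> n V s a \<le> backup_Q M \<gamma> n W s a"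
  using assms unfolding backup_Q_def restrict_def
  by (auto intro!: mult_left_mono sum_mono trans_n_nonneg)

text \<open>By \<open>backup_Q_append\<close> the left side continues with the same suffix
  \<open>drop \<tau> a\<close> in whichever state is reached. The right side picks a best suffix for
  each such state, that is, it maximizes inside the expectation.\<close>

lemma backup_Q_le_two_stage:
  assumes M: "is_pso_mdp M" and \<gamma>: "0 \<le> \<gamma>" and \<tau>: "\<tau> \<le> n" and a: "a \<in> seqs n"
  shows "backup_Q M \<gamma> n V s a \<le> backup_Q M \<gamma> \<tau> (backup_V M \<gamma> (n - \<tau>) V) s (take \<tau> a)"
proof -
  have len: "length (take \<tau> a) = \<tau>" "length (drop \<tau> a) = n - \<tau>"
    using a \<tau> by (auto simp: seqs_def)
  have "backup_Q M \<gamma> n V s a = backup_Q M \<gamma> \<tau> (\<lambda>x. backup_Q M \<gamma> (n - \<tau>) V x (drop \<tau> a)) s (take \<tau> a)"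
    using backup_Q_append[OF len(2), of M \<gamma> "take \<tau> a" V s] \<tau>
    unfolding append_take_drop_id len(1) by simp
  also have "\<dots> \<le> backup_Q M \<gamma> \<tau> (backup_V M \<gamma> (n - \<tau>) V) s (take \<tau> a)"
    using len by (intro backup_Q_mono M \<gamma> backup_Q_le_backup_V) (simp add: seqs_def)
  finally show ?thesis .
qed

text \<open>Turns any fixpoint of the full-period backup into a sub-fixpoint of the two-stage
  backup.\<close>

lemma backup_V_le_two_stage:
  assumes "is_pso_mdp M" "0 \<le> \<gamma>" "\<tau> \<le> n"
  shows "backup_V M \<gamma> n V s \<le> backup_V M \<gamma> \<tau> (backup_V M \<gamma> (n - \<tau>) V) s"
proof -
  have "backup_Q M \<gamma> n V s a \<le> backup_V M \<gamma> \<tau> (backup_V M \<gamma> (n - \<tau>) V) s" if "a \<in> seqs n" for a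
  proof -
    have "take \<tau> a \<in> seqs \<tau>" using that assms(3) by (simp add: seqs_def)
    with backup_Q_le_two_stage[OF assms that] show ?thesis
      by (rule order_trans[OF _ backup_Q_le_backup_V])
  qed
  then show ?thesis unfolding backup_V_def[of M \<gamma> n] by (intro Max.boundedI) auto
qed

text \<open>Let \<open>K\<close> be the largest excess of \<open>V\<close> over \<open>W\<close>,
  attained at \<open>s0\<close>. Then
  \<open>V s0 \<le> F V s0 \<le> F W s0 + c * K = W s0 + c * K\<close>, so
  \<open>K \<le> c * K\<close>, which forces \<open>K \<le> 0\<close>. Assumption \<open>F\<close>
  packs monotonicity (the case \<open>K = 0\<close>) and contraction into one shift
  inequality.\<close>

lemma sub_fixpoint_le_fixpoint:
  fixes F :: "('s::finite \<Rightarrow> real) \<Rightarrow> 's \<Rightarrow> real"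
  assumes c: "c < 1"
    and F: "\<And>K s. (\<And>s. V s \<le> W s + K) \<Longrightarrow> F V s \<le> F W s + c * K"
    and V: "\<And>s. V s \<le> F V s" and W: "F W = W"
  shows "V s \<le> W s"
proof -
  define K where "K = (MAX s. V s - W s)"
  have le: "V s - W s \<le> K" for s unfolding K_def by (intro Max_ge) auto
  have "K \<in> range (\<lambda>s. V s - W s)" unfolding K_def by (intro Max_in) auto
  then obtain s0 where s0: "K = V s0 - W s0" by auto
  have "F V s0 \<le> F W s0 + c * K"
    by (rule F) (use le in \<open>simp add: algebra_simps\<close>)
  with V[of s0] W s0 have "(1 - c) * K \<le> 0" by (simp add: algebra_simps)
  with c have "K \<le> 0" by (simp add: mult_le_0_iff)
  with le[of s] show ?thesis by simp
qed

theorem theorem4: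
  fixes M :: "('s::finite, 'a::finite) pso_mdp" and \<gamma> :: real and \<tau> :: nat
  assumes "is_pso_mdp M"
    and "0 \<le> \<gamma>" and "\<gamma> < 1"
    and "1 \<le> \<tau>" and "\<tau> < period M"
  shows "\<forall>s. \<forall>a\<in>seqs (period M). opt_Q M \<gamma> s a \<le> opt_Q_add M \<gamma> \<tau> s (take \<tau> a)"
proof (intro allI ballI)
  fix s and a :: "'a list"
  assume a: "a \<in> seqs (period M)"
  let ?m = "period M - \<tau>"
  define V where "V s = (MAX a\<in>seqs (period M). opt_Q M \<gamma> s a)" for s
  define W where "W s = (MAX c\<in>seqs \<tau>. opt_Q_add M \<gamma> \<tau> s c)" for s
  define U where "U s = (MAX b\<in>seqs ?m. opt_P_add M \<gamma> \<tau> s b)" for s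
  have "bellman M \<gamma> (opt_Q M \<gamma>)"
    unfolding opt_Q_def by (rule theI'[OF bellman_unique_solution[OF assms(1-3)]])
  then have Q: "opt_Q M \<gamma> = backup_Q M \<gamma> (period M) V"
    unfolding bellman_iff V_def[symmetric] .
  have "bellman_add M \<gamma> \<tau> (opt_Q_add M \<gamma> \<tau>, opt_P_add M \<gamma> \<tau>)"
    unfolding opt_Q_add_def opt_P_add_def prod.collapse
    by (rule theI'[OF bellman_add_unique_solution[OF assms]])
  then have QA: "opt_Q_add M \<gamma> \<tau> = backup_Q M \<gamma> \<tau> U" and PA: "opt_P_add M \<gamma> \<tau> = backup_Q M \<gamma> ?m W"
    unfolding bellman_add_iff U_def[symmetric] W_def[symmetric] by blast+
  \<comment> \<open>Maximizing the Bellman equations over action sequences turns them into fixpoint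
    equations for state values, where the comparison takes place.\<close>
  have V: "backup_V M \<gamma> (period M) V = V"
    by (simp add: fun_eq_iff backup_V_def flip: Q) (simp add: V_def)
  have U: "U = backup_V M \<gamma> ?m W"
    by (simp add: fun_eq_iff backup_V_def flip: PA) (simp add: U_def)
  have W: "backup_V M \<gamma> \<tau> (backup_V M \<gamma> ?m W) = W"
    unfolding U[symmetric] by (simp add: fun_eq_iff backup_V_def flip: QA) (simp add: W_def)
  have VW: "V s \<le> W s" for s
  proof (rule sub_fixpoint_le_fixpoint[where F = "\<lambda>V. backup_V M \<gamma> \<tau> (backup_V M \<gamma> ?m V)"])
    show "backup_V M \<gamma> \<tau> (backup_V M \<gamma> ?m W) = W" by (rule W)
    \<comment> \<open>The two stages together span one period, so the factor is
      \<open>\<gamma> ^ period M\<close>.\<close>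
    show "\<gamma> ^ \<tau> * \<gamma> ^ ?m < 1"
      using assms by (simp add: power_less_one_iff flip: power_add)
    show "V s \<le> backup_V M \<gamma> \<tau> (backup_V M \<gamma> ?m V) s" for s
      using backup_V_le_two_stage[of M \<gamma> \<tau> "period M" V s] assms V by simp
    show "backup_V M \<gamma> \<tau> (backup_V M \<gamma> ?m V) s \<le>
        backup_V M \<gamma> \<tau> (backup_V M \<gamma> ?m W) s + \<gamma> ^ \<tau> * \<gamma> ^ ?m * K"
      if "\<And>s. V s \<le> W s + K" for K s
      unfolding mult.assoc by (intro backup_V_le assms that)
  qed
  \<comment> \<open>Back from state values to a single sequence \<open>a\<close>: first allow a free
    choice of the suffix, then replace \<open>V\<close> by the larger \<open>W\<close>. The shift
    \<open>0\<close> in \<open>backup_V_le\<close> makes it plain monotonicity.\<close>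
  have "opt_Q M \<gamma> s a \<le> backup_Q M \<gamma> \<tau> (backup_V M \<gamma> ?m V) s (take \<tau> a)"
    unfolding Q using assms a by (intro backup_Q_le_two_stage) auto
  also have "\<dots> \<le> backup_Q M \<gamma> \<tau> (backup_V M \<gamma> ?m W) s (take \<tau> a)"
    using backup_V_le[of M \<gamma> V W 0 ?m] VW assms by (intro backup_Q_mono) auto
  also have "\<dots> = opt_Q_add M \<gamma> \<tau> s (take \<tau> a)"
    unfolding QA U ..
  finally show "opt_Q M \<gamma> s a \<le> opt_Q_add M \<gamma> \<tau> s (take \<tau> a)" .
qed

end
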